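(* Let $k,v$ be integers with $2\le k\le v$ and suppose a $(2,k,v)$-Steiner system is given. Put $r=\frac{v-1}{k-1}$, $M=\frac{v(v-1)}{k(k-1)}$ and $N=v\left(1+\frac{v-1}{k-1}\right)=v(1+r)$. Then the Steiner system generates an equiangular tight frame consisting of $N$ vectors in $M$-dimensional space, with redundancy $\frac{N}{M}=k\left(1+\frac{k-1}{v-1}\right)$ and density $\frac{k}{v}=\left(\frac{N-1}{M(N-M)}\right)^{1/2}$. Moreover, if there exists a real Hadamard matrix of size $1+\frac{v-1}{k-1}$, then such a frame can be taken to be real. Specifically, an $M\times N$ equiangular tight frame matrix $F$ with this redundancy and density is obtained by the following construction, for any choices made in it: 1. Let $A^{\mathrm T}$ be the $M\times v$ transpose of the incidence matrix of the $(2,k,v)$-Steiner system. 2. For each $j=1,\dots,v$, let $H_j$ be any $(1+r)\times(1+r)$ matrix with orthogonal rows and unimodular entries (such as a possibly complex Hadamard matrix). 3. For each $j=1,\dots,v$, let $F_j$ be the $M\times(1+r)$ matrix obtained from the $j$th column of $A^{\mathrm T}$ by replacing each of the one-valued entries with a distinct row of $H_j$, and every zero-valued entry with a row of zeros. 4. Set $F=\left(\frac{k-1}{v-1}\right)^{1/2}[F_1\ \cdots\ F_v]$.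
   Context: A finite sequence $F=\{f_n\}_{n=1}^N$ of vectors in a real or complex $M$-dimensional Hilbert space $\mathbb{H}_M$ is identified with the $M\times N$ matrix whose columns are the $f_n$. It is a tight frame if there is $A>0$ with $FF^*=A\,\mathrm{I}$. It is equiangular if $\|f_n\|=1$ for all $n$ and there is $\alpha\ge 0$ with $|\langle f_n,f_{n'}\rangle|=\alpha$ for all $n\ne n'$. An equiangular tight frame (ETF) is a sequence that is both. The redundancy of $F$ is $N/M$. The density of a matrix is the ratio of the number of its nonzero entries to the total number of its entries. A $(2,k,v)$-Steiner system is a $v$-element set $V$ together with a collection $\mathcal{B}$ of $k$-element subsets of $V$ (blocks) such that every $2$-element subset of $V$ is contained in exactly one block. Every point then lies in exactly $r=\frac{v-1}{k-1}$ blocks and there are exactly $b=\frac{v(v-1)}{k(k-1)}$ blocks. The parameters satisfy $2\le k\le v$. The transposed incidence matrix $A^{\mathrm T}$ is the $b\times v$ $\{0,1\}$-matrix, rows indexed by blocks and columns by points, having a one exactly when the block contains the point. A unimodular number is a real or complex number of modulus one. A real Hadamard matrix of size $m$ is an $m\times m$ matrix with entries $\pm1$ and orthogonal rows; a complex Hadamard matrix of size $m$ is an $m\times m$ matrix with unimodular complex entries and orthogonal rows. *)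

theory Defs
  imports Complex_Main "Jordan_Normal_Form.Schur_Decomposition"
begin

text \<open>
  Everything that makes sense over both scalar fields is stated for a type \<open>'a\<close> of sort
  \<open>{conjugatable_field, real_normed_field}\<close>; it is used at \<open>real\<close>, where \<open>conjugate\<close> is the
  identity, and at \<open>complex\<close>. A sequence of N vectors in M-dimensional space is an M-by-N
  matrix whose columns are the vectors. Rows, columns, points and blocks are numbered from 0.
\<close>

definition vec_norm2 :: "'a::real_normed_field vec \<Rightarrow> real" where
  "vec_norm2 f = sqrt (\<Sum>i<dim_vec f. (norm (f $ i))\<^sup>2)"

definition tight_frame :: "'a::{conjugatable_field, real_normed_field} mat \<Rightarrow> bool" where
  "tight_frame F \<longleftrightarrow>
     (\<exists>A::real. A > 0 \<and> F * mat_adjoint F = of_real A \<cdot>\<^sub>m 1\<^sub>m (dim_row F))"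

definition equiangular :: "'a::{conjugatable_field, real_normed_field} mat \<Rightarrow> bool" where
  "equiangular F \<longleftrightarrow>
     (\<forall>n<dim_col F. vec_norm2 (col F n) = 1) \<and>
     (\<exists>\<alpha>::real. \<alpha> \<ge> 0 \<and>
        (\<forall>n<dim_col F. \<forall>n'<dim_col F. n \<noteq> n' \<longrightarrow> norm (col F n \<bullet>c col F n') = \<alpha>))"

definition equiangular_tight_frame ::
  "'a::{conjugatable_field, real_normed_field} mat \<Rightarrow> bool" where
  "equiangular_tight_frame F \<longleftrightarrow> equiangular F \<and> tight_frame F"

definition redundancy :: "'a mat \<Rightarrow> real" where
  "redundancy F = real (dim_col F) / real (dim_row F)"

definition density :: "'a::zero mat \<Rightarrow> real" where
  "density F =
     real (card {(i, j). i < dim_row F \<and> j < dim_col F \<and> F $$ (i, j) \<noteq> 0}) /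
     real (dim_row F * dim_col F)"

definition steiner_system :: "nat \<Rightarrow> nat \<Rightarrow> 'p set \<Rightarrow> 'p set set \<Rightarrow> bool" where
  "steiner_system k v V \<B> \<longleftrightarrow>
     finite V \<and> card V = v \<and>
     (\<forall>B\<in>\<B>. B \<subseteq> V \<and> card B = k) \<and>
     (\<forall>P. P \<subseteq> V \<and> card P = 2 \<longrightarrow> (\<exists>!B. B \<in> \<B> \<and> P \<subseteq> B))"

text \<open>
  The list \<open>ps\<close> enumerates the points (rows) and \<open>bs\<close> the blocks (columns), each without
  repetition.
\<close>

definition incidence_matrix :: "'p list \<Rightarrow> 'p set list \<Rightarrow> nat mat" where
  "incidence_matrix ps bs =
     mat (length ps) (length bs) (\<lambda>(j, i). if ps ! j \<in> bs ! i then 1 else 0)"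

text \<open>Over the complex numbers these are exactly the complex Hadamard matrices of size \<open>m\<close>.\<close>

definition unimodular_orthogonal_rows ::
  "nat \<Rightarrow> 'a::{conjugatable_field, real_normed_field} mat \<Rightarrow> bool" where
  "unimodular_orthogonal_rows m H \<longleftrightarrow>
     H \<in> carrier_mat m m \<and>
     (\<forall>i<m. \<forall>j<m. norm (H $$ (i, j)) = 1) \<and>
     (\<forall>i<m. \<forall>i'<m. i \<noteq> i' \<longrightarrow> row H i \<bullet>c row H i' = 0)"

definition real_hadamard :: "nat \<Rightarrow> real mat \<Rightarrow> bool" where
  "real_hadamard m H \<longleftrightarrow>
     H \<in> carrier_mat m m \<and>
     (\<forall>i<m. \<forall>j<m. H $$ (i, j) = 1 \<or> H $$ (i, j) = - 1) \<and>
     (\<forall>i<m. \<forall>i'<m. i \<noteq> i' \<longrightarrow> row H i \<bullet> row H i' = 0)"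

definition hconcat :: "nat \<Rightarrow> 'a mat list \<Rightarrow> 'a mat" where
  "hconcat m Fs = mat_of_cols m (concat (map cols Fs))"

text \<open>
  Column \<open>j\<close> of \<open>AT\<close> with its ones replaced by rows of \<open>H\<close>, where \<open>s i\<close> is the index of the
  row of \<open>H\<close> that goes into row \<open>i\<close>, and its zeros by zero rows of length \<open>m\<close>. That the
  rows used are distinct is required in \<open>steiner_construction\<close>.
\<close>

definition replace_ones ::
  "nat \<Rightarrow> nat mat \<Rightarrow> nat \<Rightarrow> 'a::zero mat \<Rightarrow> (nat \<Rightarrow> nat) \<Rightarrow> 'a mat" where
  "replace_ones m AT j H s =
     mat_of_rows m
       (map (\<lambda>i. if AT $$ (i, j) = 1 then row H (s i) else 0\<^sub>v m) [0..<dim_row AT])"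

text \<open>
  \<open>F\<close> is a possible outcome of the construction from the transposed incidence matrix \<open>AT\<close>,
  for some choice of the matrices \<open>H j\<close> (which may depend on \<open>j\<close>) and of the assignments
  \<open>s j\<close> of their rows to the blocks through point \<open>j\<close>.
\<close>

definition steiner_construction ::
  "nat \<Rightarrow> nat \<Rightarrow> nat \<Rightarrow> nat mat \<Rightarrow> 'a::{conjugatable_field, real_normed_field} mat \<Rightarrow> bool"
  where
  "steiner_construction k v r AT F \<longleftrightarrow>
     (\<exists>H s.
        (\<forall>j<v. unimodular_orthogonal_rows (1 + r) (H j)) \<and>
        (\<forall>j<v. inj_on (s j) {i. i < dim_row AT \<and> AT $$ (i, j) = 1} \<and>
               (\<forall>i<dim_row AT. AT $$ (i, j) = 1 \<longrightarrow> s j i < 1 + r)) \<and>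
        F = of_real (sqrt ((real k - 1) / (real v - 1))) \<cdot>\<^sub>m
              hconcat (dim_row AT)
                (map (\<lambda>j. replace_ones (1 + r) AT j (H j) (s j)) [0..<v]))"

end

theory Submission
  imports Defs
begin

text \<open>
  Call the columns of \<open>F\<close> coming from \<open>F\<^sub>j\<close> the columns at the point \<open>j\<close>; each is supported on the
  \<open>r\<close> blocks through \<open>j\<close>. The frame is equiangular because the inner product of two distinct columns is,
  before scaling, a unimodular number in both of the possible cases.

  \<^item> Columns at distinct points: exactly one block contains both points, so the supports meet in a single
  coordinate and the inner product is one unimodular product (\<open>distinct_points_product\<close>).
  \<^item> Columns at the same point: these are two columns of \<open>H\<^sub>j\<close> with one entry deleted, since only \<open>r\<close> of
  the \<open>1 + r\<close> rows are used. As \<open>H\<^sub>j\<close> is square, orthogonality of its rows forces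
  orthogonality of its columns (\<open>unimodular_orthogonal_columns\<close>), so the inner product is the negative
  of the deleted term (\<open>same_point_product\<close>).

  A column has \<open>r\<close> unimodular entries, hence the scaling by \<open>1 / sqrt r = sqrt ((k - 1) / (v - 1))\<close> gives unit
  norm, and the common modulus is \<open>1 / r\<close>. It is this asymmetry, one more row in \<open>H\<^sub>j\<close> than there are
  blocks through a point, that makes the two cases agree.

  Tightness means that the rows of \<open>F\<close> are orthogonal and of equal norm. Within one \<open>F\<^sub>j\<close> two distinct
  nonzero rows are distinct rows of \<open>H\<^sub>j\<close>, hence orthogonal; and a row meets the \<open>k\<close> points of its block,
  each contributing \<open>1 + r\<close> unimodular entries (\<open>row_product\<close>). The same count gives the density.

  The parameter identities rest on two double counts: \<open>r (k - 1) = v - 1\<close> from the points other than a given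
  one, and \<open>M k = v r\<close> from the incident pairs. Complex frames always exist because the Fourier matrix can
  serve for every \<open>H\<^sub>j\<close>; for a real frame a real Hadamard matrix takes its place.
\<close>

section \<open>Incidence counts in a Steiner system\<close>

lemma card_nth_eq_card_set:
  assumes "distinct xs"
  shows "card {i. i < length xs \<and> P (xs ! i)} = card {x \<in> set xs. P x}"
proof -
  have "(!) xs ` {i. i < length xs \<and> P (xs ! i)} = {x \<in> set xs. P x}"
    by (auto simp: in_set_conv_nth)
  moreover have "inj_on ((!) xs) {i. i < length xs \<and> P (xs ! i)}"
    using assms by (auto simp: inj_on_def nth_eq_iff_index_eq)
  ultimately show ?thesis by (metis card_image)
qed

lemma steiner_systemD:
  assumes "steiner_system k v V \<B>"
  shows "finite V" "card V = v" "B \<in> \<B> \<Longrightarrow> B \<subseteq> V" "B \<in> \<B> \<Longrightarrow> card B = k"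
proof -
  note S = assms[unfolded steiner_system_def]
  show "finite V" by (rule conjunct1[OF S])
  show "card V = v" by (rule conjunct1[OF conjunct2[OF S]])
  have "\<forall>B\<in>\<B>. B \<subseteq> V \<and> card B = k" by (rule conjunct1[OF conjunct2[OF conjunct2[OF S]]])
  then show "B \<in> \<B> \<Longrightarrow> B \<subseteq> V" "B \<in> \<B> \<Longrightarrow> card B = k" by simp_all
qed

lemma ex1_unique: "\<exists>!x. P x \<Longrightarrow> P x \<Longrightarrow> P y \<Longrightarrow> x = y"
  by blast

lemma steiner_system_common_block:
  assumes "steiner_system k v V \<B>" "p \<in> V" "q \<in> V" "p \<noteq> q"
  shows "\<exists>!B. B \<in> \<B> \<and> p \<in> B \<and> q \<in> B"
proof -
  have "{p, q} \<subseteq> V \<and> card {p, q} = 2"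
    using assms by simp
  moreover have "\<forall>P. P \<subseteq> V \<and> card P = 2 \<longrightarrow> (\<exists>!B. B \<in> \<B> \<and> P \<subseteq> B)"
    using assms(1) unfolding steiner_system_def by (elim conjE)
  ultimately have "\<exists>!B. B \<in> \<B> \<and> {p, q} \<subseteq> B" by (elim allE[of _ "{p, q}"] impE)
  then show ?thesis by simp
qed

lemma steiner_system_finite_blocks:
  assumes "steiner_system k v V \<B>"
  shows "finite \<B>"
proof (rule finite_subset)
  show "\<B> \<subseteq> Pow V" using steiner_systemD(3)[OF assms] by auto
qed (simp add: steiner_systemD(1)[OF assms])

text \<open>
  The blocks through \<open>p\<close> with \<open>p\<close> removed partition the other \<open>v - 1\<close> points into parts of size \<open>k - 1\<close>.
\<close>

lemma steiner_system_degree: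
  assumes S: "steiner_system k v V \<B>" and p: "p \<in> V"
  shows "card {B \<in> \<B>. p \<in> B} * (k - 1) = v - 1"
proof -
  let ?S = "{B \<in> \<B>. p \<in> B}"
  note V = steiner_systemD(1,2)[OF S] and B = steiner_systemD(3,4)[OF S]
  have "V - {p} = (\<Union>B\<in>?S. B - {p})"
  proof (intro equalityI subsetI)
    fix q assume "q \<in> V - {p}"
    then obtain B where "B \<in> \<B>" "p \<in> B" "q \<in> B"
      using ex1_implies_ex[OF steiner_system_common_block[OF S p, of q]] by auto
    then show "q \<in> (\<Union>B\<in>?S. B - {p})" using \<open>q \<in> V - {p}\<close> by auto
  next
    fix q assume "q \<in> (\<Union>B\<in>?S. B - {p})"
    then show "q \<in> V - {p}" using B by auto
  qed
  moreover have "card (\<Union>B\<in>?S. B - {p}) = (\<Sum>B\<in>?S. card (B - {p}))"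
  proof (rule card_UN_disjoint)
    show "finite ?S" using steiner_system_finite_blocks[OF S] by simp
    show "\<forall>B\<in>?S. finite (B - {p})" using B finite_subset[OF _ V(1)] by simp
    have "(B - {p}) \<inter> (C - {p}) = {}" if BC: "B \<in> ?S" "C \<in> ?S" "B \<noteq> C" for B C
    proof (rule equals0I)
      fix q assume q: "q \<in> (B - {p}) \<inter> (C - {p})"
      then have "q \<in> V" "p \<noteq> q" using B[of B] BC(1) by auto
      then have ex: "\<exists>!B. B \<in> \<B> \<and> p \<in> B \<and> q \<in> B"
        by (rule steiner_system_common_block[OF S p])
      have "B \<in> \<B> \<and> p \<in> B \<and> q \<in> B" "C \<in> \<B> \<and> p \<in> C \<and> q \<in> C"
        using BC q by simp_all
      with ex have "B = C" by (rule ex1_unique)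
      with BC show False by simp
    qed
    then show "\<forall>B\<in>?S. \<forall>C\<in>?S. B \<noteq> C \<longrightarrow> (B - {p}) \<inter> (C - {p}) = {}" by blast
  qed
  moreover have "(\<Sum>B\<in>?S. card (B - {p})) = (\<Sum>B\<in>?S. k - 1)"
    using B by (intro sum.cong) auto
  ultimately have "card (V - {p}) = card ?S * (k - 1)" by simp
  then show ?thesis using V p by simp
qed

text \<open>
  Both sides count the incident pairs of a point and a block.
\<close>

lemma steiner_system_block_count:
  assumes S: "steiner_system k v V \<B>" and r: "\<And>p. p \<in> V \<Longrightarrow> card {B \<in> \<B>. p \<in> B} = r"
  shows "card \<B> * k = v * r"
proof -
  note V = steiner_systemD(1,2)[OF S]
  have B: "{p \<in> V. p \<in> B} = B" "card B = k" if "B \<in> \<B>" for B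
    using steiner_systemD(3,4)[OF S that] by auto
  have "(\<Sum>p\<in>V. card {B \<in> \<B>. p \<in> B}) = k * card \<B>"
  proof (rule sum_multicount)
    show "\<forall>B\<in>\<B>. card {p \<in> V. p \<in> B} = k"
    proof
      fix B assume "B \<in> \<B>"
      then show "card {p \<in> V. p \<in> B} = k" using B by metis
    qed
  qed (fact V(1), fact steiner_system_finite_blocks[OF S])
  also have "(\<Sum>p\<in>V. card {B \<in> \<B>. p \<in> B}) = v * r" using r V(2) by simp
  finally show ?thesis by simp
qed

text \<open>
  The properties of the incidence pattern that the frame depends on, with points and blocks reduced to
  their numbers: \<open>inc i j\<close> says that block \<open>i\<close> contains point \<open>j\<close>.
\<close>

locale steiner_incidence =
  fixes M v k r :: nat and inc :: "nat \<Rightarrow> nat \<Rightarrow> bool"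
  assumes k_pos: "0 < k" and r_pos: "0 < r"
    and blocks_through: "j < v \<Longrightarrow> card {i. i < M \<and> inc i j} = r"
    and points_on: "i < M \<Longrightarrow> card {j. j < v \<and> inc i j} = k"
    and common_block: "j < v \<Longrightarrow> j' < v \<Longrightarrow> j \<noteq> j' \<Longrightarrow> \<exists>!i. i < M \<and> inc i j \<and> inc i j'"

lemma steiner_system_incidence:
  assumes k: "2 \<le> k" "k \<le> v" and S: "steiner_system k v V \<B>"
    and ps: "distinct ps" "set ps = V" and bs: "distinct bs" "set bs = \<B>"
    and AT: "AT = transpose_mat (incidence_matrix ps bs)"
    and r: "r = (v - 1) div (k - 1)" and M: "M = (v * (v - 1)) div (k * (k - 1))"
  shows "r * (k - 1) = v - 1" "M * k = v * r" "AT \<in> carrier_mat M v"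
    "steiner_incidence M v k r (\<lambda>i j. AT $$ (i, j) = 1)"
proof -
  have v: "length ps = v" using ps steiner_systemD(2)[OF S] distinct_card by metis
  have deg: "card {B \<in> \<B>. p \<in> B} = r" if "p \<in> V" for p
  proof -
    have "card {B \<in> \<B>. p \<in> B} * (k - 1) div (k - 1) = card {B \<in> \<B>. p \<in> B}"
      using k by (intro nonzero_mult_div_cancel_right) simp
    then show ?thesis unfolding r steiner_system_degree[OF S that] by simp
  qed
  have "ps ! 0 \<in> V" using nth_mem[of 0 ps] ps v k by simp
  then show r1: "r * (k - 1) = v - 1" using steiner_system_degree[OF S] deg by simp
  have count: "card \<B> * k = v * r" using S deg by (rule steiner_system_block_count)
  have cB: "card \<B> = length bs" using bs distinct_card by blast
  have "length bs * (k * (k - 1)) = card \<B> * k * (k - 1)" unfolding cB by simp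
  also have "\<dots> = v * (v - 1)"
    unfolding count by (simp only: mult.assoc r1)
  finally have "length bs * (k * (k - 1)) div (k * (k - 1)) = M" unfolding M by simp
  then have lM: "length bs = M"
    using k by (subst (asm) nonzero_mult_div_cancel_right) auto
  show Mk: "M * k = v * r"
    using count cB lM by simp
  show AC: "AT \<in> carrier_mat M v" unfolding AT incidence_matrix_def using lM v by simp
  have inc: "AT $$ (i, j) = 1 \<longleftrightarrow> ps ! j \<in> bs ! i" if "i < M" "j < v" for i j
    using that unfolding AT incidence_matrix_def by (simp add: lM v)
  show "steiner_incidence M v k r (\<lambda>i j. AT $$ (i, j) = 1)"
  proof
    show "0 < k" using k by simp
    show "0 < r"
    proof (rule gr0I)
      assume "r = 0"
      then have "v - 1 = 0" using r1 by simp
      then show False using k by simp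
    qed
  next
    fix j assume j: "j < v"
    have "{i. i < M \<and> AT $$ (i, j) = 1} = {i. i < length bs \<and> ps ! j \<in> bs ! i}"
      using inc j lM by auto
    then have "card {i. i < M \<and> AT $$ (i, j) = 1} = card {i. i < length bs \<and> ps ! j \<in> bs ! i}"
      by (rule arg_cong)
    also have "\<dots> = card {B \<in> \<B>. ps ! j \<in> B}"
      using card_nth_eq_card_set[OF bs(1)] unfolding bs(2) .
    also have "\<dots> = r" using j v ps by (intro deg) auto
    finally show "card {i. i < M \<and> AT $$ (i, j) = 1} = r" .
  next
    fix i assume i: "i < M"
    have B: "bs ! i \<in> \<B>" using i lM bs by auto
    have "{j. j < v \<and> AT $$ (i, j) = 1} = {j. j < length ps \<and> ps ! j \<in> bs ! i}"
      using inc i v by auto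
    then have "card {j. j < v \<and> AT $$ (i, j) = 1} = card {j. j < length ps \<and> ps ! j \<in> bs ! i}"
      by (rule arg_cong)
    also have "\<dots> = card {p \<in> V. p \<in> bs ! i}"
      using card_nth_eq_card_set[OF ps(1)] unfolding ps(2) .
    also have "{p \<in> V. p \<in> bs ! i} = bs ! i" using steiner_systemD(3)[OF S B] by auto
    also have "card \<dots> = k" using S B by (rule steiner_systemD(4))
    finally show "card {j. j < v \<and> AT $$ (i, j) = 1} = k" .
  next
    fix j j' assume j: "j < v" "j' < v" "j \<noteq> j'"
    have "ps ! j \<noteq> ps ! j'" using j ps v by (simp add: nth_eq_iff_index_eq)
    moreover have "ps ! j \<in> V" "ps ! j' \<in> V" using j ps v by auto
    ultimately have ex: "\<exists>!B. B \<in> \<B> \<and> ps ! j \<in> B \<and> ps ! j' \<in> B"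
      by (intro steiner_system_common_block[OF S])
    then obtain B where B: "B \<in> \<B>" "ps ! j \<in> B" "ps ! j' \<in> B"
      by (elim ex1E conjE)
    obtain i where i: "i < M" "bs ! i = B" using B(1) bs lM by (metis in_set_conv_nth)
    show "\<exists>!i. i < M \<and> AT $$ (i, j) = 1 \<and> AT $$ (i, j') = 1"
    proof (rule ex1I[of _ i])
      show "i < M \<and> AT $$ (i, j) = 1 \<and> AT $$ (i, j') = 1" using inc i j B by simp
      fix i' assume "i' < M \<and> AT $$ (i', j) = 1 \<and> AT $$ (i', j') = 1"
      then have i': "i' < M" "ps ! j \<in> bs ! i'" "ps ! j' \<in> bs ! i'" using inc j by auto
      moreover have "bs ! i' \<in> \<B>" using i' lM bs by auto
      ultimately have "bs ! i' = B" using ex1_unique[OF ex] B by simp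
      then show "i' = i" using nth_eq_iff_index_eq[OF bs(1), of i' i] i i' lM by simp
    qed
  qed
qed

section \<open>Matrices with unimodular entries and orthogonal rows\<close>

text \<open>
  The real and the complex case are treated together. The assumption of the following lemmas,
  \<open>z * conjugate z = |z|\<^sup>2\<close>, is the link between conjugation and norm that both scalar fields share.
\<close>

lemma norm_conjugate:
  fixes z :: "'a::{conjugatable_field, real_normed_field}"
  assumes "\<And>z :: 'a. z * conjugate z = of_real ((norm z)\<^sup>2)"
  shows "norm (conjugate z) = norm z"
proof (cases "z = 0")
  case False
  have "norm z * norm (conjugate z) = norm z * norm z"
    using arg_cong[OF assms[of z], of norm] by (simp add: norm_mult power2_eq_square)
  then show ?thesis using False by simp
qed simp

lemma conjugate_of_real:
  assumes "\<And>z :: 'a::{conjugatable_field, real_normed_field}. z * conjugate z = of_real ((norm z)\<^sup>2)"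
  shows "conjugate (of_real x :: 'a) = of_real x"
proof (cases "x = 0")
  case False
  have "(of_real x :: 'a) * conjugate (of_real x) = of_real x * of_real x"
    using assms[of "of_real x"] by (simp add: power2_eq_square)
  then show ?thesis using False by simp
qed simp

lemma cscalar_prod_eq_sum:
  assumes "dim_vec y = n"
  shows "x \<bullet>c y = (\<Sum>i<n. x $ i * conjugate (y $ i))"
  unfolding scalar_prod_def using assms by (auto simp: atLeast0LessThan intro!: sum.cong)

lemma mult_mat_adjoint_index:
  assumes "i < dim_row A" "j < dim_row B" "dim_col B = dim_col A"
  shows "(A * mat_adjoint B) $$ (i, j) = (\<Sum>c<dim_col A. A $$ (i, c) * conjugate (B $$ (j, c)))"
  using assms unfolding mat_adjoint_def
  by (auto simp: scalar_prod_def mat_of_rows_index atLeast0LessThan intro!: sum.cong)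

lemma mat_adjoint_mult_index:
  assumes "i < dim_col A" "j < dim_col B" "dim_row B = dim_row A"
  shows "(mat_adjoint A * B) $$ (i, j) = (\<Sum>c<dim_row A. conjugate (A $$ (c, i)) * B $$ (c, j))"
  using assms unfolding mat_adjoint_def
  by (auto simp: scalar_prod_def mat_of_rows_index atLeast0LessThan intro!: sum.cong)

lemma unimodular_row_products:
  fixes H :: "'a::{conjugatable_field, real_normed_field} mat"
  assumes cn: "\<And>z :: 'a. z * conjugate z = of_real ((norm z)\<^sup>2)"
    and H: "unimodular_orthogonal_rows m H" and i: "i < m" "i' < m"
  shows "(\<Sum>c<m. H $$ (i, c) * conjugate (H $$ (i', c))) = (if i = i' then of_nat m else 0)"
proof (cases "i = i'")
  case True
  have "(\<Sum>c<m. H $$ (i, c) * conjugate (H $$ (i, c))) = (\<Sum>c<m. 1)"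
    using H i unfolding unimodular_orthogonal_rows_def by (intro sum.cong) (auto simp: cn)
  then show ?thesis using True by simp
next
  case False
  have "H \<in> carrier_mat m m" using H unfolding unimodular_orthogonal_rows_def by simp
  then have "row H i \<bullet>c row H i' = (\<Sum>c<m. H $$ (i, c) * conjugate (H $$ (i', c)))"
    using i by (subst cscalar_prod_eq_sum[of _ m]) (auto intro!: sum.cong)
  then show ?thesis using False H i unfolding unimodular_orthogonal_rows_def by simp
qed

text \<open>
  The rows being orthogonal of squared norm \<open>m\<close> says that \<open>(1 / m) H\<^sup>*\<close> is a right inverse of \<open>H\<close>. For a
  square matrix it is then also a left inverse, and this is orthogonality of the columns.
\<close>

lemma unimodular_orthogonal_columns:
  fixes H :: "'a::{conjugatable_field, real_normed_field} mat"
  assumes cn: "\<And>z :: 'a. z * conjugate z = of_real ((norm z)\<^sup>2)"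
    and H: "unimodular_orthogonal_rows m H" and c: "c < m" "c' < m" "c \<noteq> c'"
  shows "(\<Sum>i<m. H $$ (i, c) * conjugate (H $$ (i, c'))) = 0"
proof -
  have C: "H \<in> carrier_mat m m" using H unfolding unimodular_orthogonal_rows_def by simp
  have AC: "mat_adjoint H \<in> carrier_mat m m" using C unfolding mat_adjoint_def by auto
  let ?B = "(1 / of_nat m) \<cdot>\<^sub>m mat_adjoint H"
  have m: "(of_nat m :: 'a) \<noteq> 0" using c by simp
  have "H * ?B = 1\<^sub>m m"
  proof (rule eq_matI)
    fix i j assume "i < dim_row (1\<^sub>m m :: 'a mat)" "j < dim_col (1\<^sub>m m :: 'a mat)"
    then have ij: "i < m" "j < m" by auto
    have "(H * ?B) $$ (i, j) = (1 / of_nat m) * (H * mat_adjoint H) $$ (i, j)"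
      using C AC ij by (subst mult_smult_distrib[of _ m m _ m]) auto
    also have "(H * mat_adjoint H) $$ (i, j) = (if i = j then of_nat m else 0)"
      using C ij unimodular_row_products[OF cn H ij] by (subst mult_mat_adjoint_index) auto
    finally show "(H * ?B) $$ (i, j) = 1\<^sub>m m $$ (i, j)" using ij m by simp
  qed (use C AC in auto)
  then have "?B * H = 1\<^sub>m m" using C AC by (intro mat_mult_left_right_inverse[of H m]) auto
  then have "(1 / of_nat m) * (mat_adjoint H * H) $$ (c', c) = 0"
    using C AC c by (metis index_smult_mat(1) index_one_mat(1) mult_smult_assoc_mat
        carrier_matD index_mult_mat(2,3))
  then have "(mat_adjoint H * H) $$ (c', c) = 0" using m by simp
  then show ?thesis using C c by (subst (asm) mat_adjoint_mult_index) (auto simp: mult.commute)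
qed

text \<open>
  The product of two distinct rows is a geometric sum whose ratio \<open>z\<close> satisfies \<open>z\<^sup>m = 1\<close> and \<open>z \<noteq> 1\<close>.
\<close>

lemma fourier_matrix_unimodular_orthogonal_rows:
  assumes "0 < m"
  shows "unimodular_orthogonal_rows m
    (mat m m (\<lambda>(i, j). cis (2 * pi * real i / real m) ^ j))"
    (is "unimodular_orthogonal_rows m ?H")
proof -
  let ?w = "\<lambda>i. cis (2 * pi * real i / real m)"
  have "row ?H i \<bullet>c row ?H i' = 0" if i: "i < m" "i' < m" "i \<noteq> i'" for i i'
  proof -
    let ?z = "?w i * cnj (?w i')"
    note bij = bij_betw_roots_unity[OF assms]
    have "?w i ^ m = 1" "?w i' ^ m = 1"
      using bij_betwE[OF bij] i by auto
    then have zm: "?z ^ m = 1" by (simp only: power_mult_distrib complex_cnj_power[symmetric]) simp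
    have "?w i \<noteq> ?w i'" using bij i unfolding bij_betw_def inj_on_def by blast
    moreover have "?w i = ?w i'" if "?z = 1"
    proof -
      have "?w i = ?z * ?w i'" by (simp add: cis_cnj cis_mult)
      then show ?thesis using that by simp
    qed
    ultimately have z1: "?z \<noteq> 1" by blast
    have "row ?H i \<bullet>c row ?H i' = (\<Sum>j<m. ?z ^ j)"
      using i by (subst cscalar_prod_eq_sum[of _ m]) (auto simp: power_mult_distrib intro!: sum.cong)
    also have "\<dots> = 0" using z1 zm by (simp add: geometric_sum)
    finally show ?thesis .
  qed
  then show ?thesis unfolding unimodular_orthogonal_rows_def by (simp add: norm_power)
qed

lemma real_hadamard_unimodular_orthogonal_rows:
  assumes "real_hadamard m H"
  shows "unimodular_orthogonal_rows m H"
proof -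
  have "conjugate x = x" for x :: "real vec" by (rule eq_vecI) auto
  then show ?thesis using assms
    unfolding real_hadamard_def unimodular_orthogonal_rows_def by fastforce
qed

section \<open>Entries of the constructed matrix\<close>

lemma block_index_less:
  fixes j :: nat
  assumes "j < v" "c < m"
  shows "j * m + c < v * m"
proof -
  have "j * m + c < Suc j * m" using assms by simp
  also have "\<dots> \<le> v * m" using assms by (intro mult_le_mono1) simp
  finally show ?thesis .
qed

lemma concat_equal_lengths:
  assumes "\<And>xs. xs \<in> set xss \<Longrightarrow> length xs = m"
  shows "length (concat xss) = length xss * m"
    "j < length xss \<Longrightarrow> c < m \<Longrightarrow> concat xss ! (j * m + c) = xss ! j ! c"
proof -
  show "length (concat xss) = length xss * m" using assms by (induction xss) auto
  show "j < length xss \<Longrightarrow> c < m \<Longrightarrow> concat xss ! (j * m + c) = xss ! j ! c"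
    using assms
  proof (induction xss arbitrary: j)
    case (Cons xs xss)
    then show ?case by (cases j) (auto simp: nth_append)
  qed simp
qed

lemma hconcat_carrier:
  assumes "\<And>A. A \<in> set As \<Longrightarrow> A \<in> carrier_mat n m"
  shows "hconcat n As \<in> carrier_mat n (length As * m)"
  using concat_equal_lengths(1)[of "map cols As" m] assms unfolding hconcat_def by fastforce

lemma hconcat_index:
  assumes As: "\<And>A. A \<in> set As \<Longrightarrow> A \<in> carrier_mat n m" and "i < n" "j < length As" "c < m"
  shows "hconcat n As $$ (i, j * m + c) = As ! j $$ (i, c)"
proof -
  have len: "length xs = m" if "xs \<in> set (map cols As)" for xs using that As by fastforce
  have "j * m + c < length (concat (map cols As))"
    using block_index_less[OF assms(3,4)] concat_equal_lengths(1)[of "map cols As" m] len by simp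
  moreover have "dim_row (As ! j) = n" "dim_col (As ! j) = m" using As[of "As ! j"] assms(3) by simp_all
  ultimately show ?thesis
    using assms concat_equal_lengths(2)[of "map cols As" m j c] len
    unfolding hconcat_def by (simp add: mat_of_cols_index)
qed

section \<open>The frame\<close>

text \<open>
  A matrix of the constructed form, described by its entries: column \<open>j * m + c\<close> is the column \<open>c\<close> of the
  \<open>j\<close>th of the \<open>v\<close> submatrices of width \<open>m\<close>. The width has a name of its own so that
  the column index \<open>j * m + c\<close> keeps this form and is not expanded in \<open>r\<close>.
\<close>

locale steiner_frame = steiner_incidence M v k r inc
  for M v k r :: nat and inc :: "nat \<Rightarrow> nat \<Rightarrow> bool" +
  fixes m :: nat and H :: "nat \<Rightarrow> 'a::{conjugatable_field, real_normed_field} mat"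
    and s :: "nat \<Rightarrow> nat \<Rightarrow> nat" and F :: "'a mat"
  assumes conjugate_norm: "\<And>z :: 'a. z * conjugate z = of_real ((norm z)\<^sup>2)"
    and m_eq: "m = 1 + r"
    and H: "j < v \<Longrightarrow> unimodular_orthogonal_rows m (H j)"
    and s_inj: "j < v \<Longrightarrow> inj_on (s j) {i. i < M \<and> inc i j}"
    and s_less: "j < v \<Longrightarrow> i < M \<Longrightarrow> inc i j \<Longrightarrow> s j i < m"
    and F_carrier: "F \<in> carrier_mat M (v * m)"
    and F_index: "i < M \<Longrightarrow> j < v \<Longrightarrow> c < m \<Longrightarrow>
      F $$ (i, j * m + c) =
        of_real (1 / sqrt r) * (if inc i j then H j $$ (s j i, c) else 0)"
begin

lemma index_cases:
  assumes "n < v * m"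
  obtains j c where "j < v" "c < m" "n = j * m + c"
proof
  show "n div m < v" using assms by (simp add: less_mult_imp_div_less)
  show "n mod m < m" by (simp add: m_eq)
  show "n = n div m * m + n mod m" by (rule div_mult_mod_eq[symmetric])
qed

lemma norm_H: "j < v \<Longrightarrow> i < M \<Longrightarrow> inc i j \<Longrightarrow> c < m \<Longrightarrow> norm (H j $$ (s j i, c)) = 1"
  using H s_less unfolding unimodular_orthogonal_rows_def by blast

lemma scale_square: "(of_real (1 / sqrt r) :: 'a) * of_real (1 / sqrt r) = of_real (1 / r)"
proof -
  have "1 / sqrt r * (1 / sqrt r) = 1 / real r" using r_pos by simp
  then show ?thesis by (metis of_real_mult)
qed

lemma F_product:
  assumes "i < M" "i' < M" "j < v" "j' < v" "c < m" "c' < m"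
  shows "F $$ (i, j * m + c) * conjugate (F $$ (i', j' * m + c')) =
    of_real (1 / r) * (if inc i j \<and> inc i' j'
      then H j $$ (s j i, c) * conjugate (H j' $$ (s j' i', c')) else 0)"
proof -
  have "F $$ (i, j * m + c) * conjugate (F $$ (i', j' * m + c')) =
    (of_real (1 / sqrt r) * of_real (1 / sqrt r)) * (if inc i j \<and> inc i' j'
      then H j $$ (s j i, c) * conjugate (H j' $$ (s j' i', c')) else 0)"
    by (simp add: F_index[OF assms(1,3,5)] F_index[OF assms(2,4,6)] conjugate_dist_mul
        conjugate_of_real[OF conjugate_norm] del: of_real_divide of_real_mult)
  then show ?thesis unfolding scale_square .
qed

lemma column_product:
  assumes "j < v" "j' < v" "c < m" "c' < m"
  shows "col F (j * m + c) \<bullet>c col F (j' * m + c') =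
    of_real (1 / r) * (\<Sum>i | i < M \<and> inc i j \<and> inc i j'.
      H j $$ (s j i, c) * conjugate (H j' $$ (s j' i, c')))"
proof -
  have "col F (j * m + c) \<bullet>c col F (j' * m + c') =
      (\<Sum>i<M. F $$ (i, j * m + c) * conjugate (F $$ (i, j' * m + c')))"
    using F_carrier block_index_less assms
    by (subst cscalar_prod_eq_sum[of _ M]) (auto intro!: sum.cong)
  also have "\<dots> = of_real (1 / r) * (\<Sum>i<M. if inc i j \<and> inc i j'
      then H j $$ (s j i, c) * conjugate (H j' $$ (s j' i, c')) else 0)"
    unfolding sum_distrib_left using assms by (intro sum.cong refl F_product) auto
  also have "(\<Sum>i<M. if inc i j \<and> inc i j'
      then H j $$ (s j i, c) * conjugate (H j' $$ (s j' i, c')) else 0) =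
    (\<Sum>i | i < M \<and> inc i j \<and> inc i j'.
      H j $$ (s j i, c) * conjugate (H j' $$ (s j' i, c')))"
    by (subst sum.inter_filter[symmetric]) (auto intro!: sum.cong)
  finally show ?thesis .
qed

lemma column_norm:
  assumes "j < v" "c < m"
  shows "vec_norm2 (col F (j * m + c)) = 1"
proof -
  have "(\<Sum>i<dim_vec (col F (j * m + c)). (norm (col F (j * m + c) $ i))\<^sup>2) =
      (\<Sum>i<M. if inc i j then 1 / real r else 0)"
  proof (rule sum.cong)
    fix i assume i: "i \<in> {..<M}"
    have "col F (j * m + c) $ i = F $$ (i, j * m + c)"
      using F_carrier block_index_less[OF assms] i by simp
    also have "(norm \<dots>)\<^sup>2 = (if inc i j then 1 / real r else 0)"
      using F_index[of i j c] norm_H[of j i c] i assms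
      by (simp add: norm_mult norm_divide power_divide)
    finally show "(norm (col F (j * m + c) $ i))\<^sup>2 = (if inc i j then 1 / real r else 0)" .
  qed (use F_carrier in simp)
  also have "\<dots> = (\<Sum>i | i < M \<and> inc i j. 1 / real r)"
    by (subst sum.inter_filter[symmetric]) (auto intro!: sum.cong)
  also have "\<dots> = 1" using blocks_through assms r_pos by simp
  finally show ?thesis unfolding vec_norm2_def by simp
qed

text \<open>
  Exactly one row \<open>t\<close> of \<open>H j\<close> is not used at the point \<open>j\<close>. The columns of \<open>H j\<close> are orthogonal, so the
  sum over the used rows is the negative of the term at \<open>t\<close>.
\<close>

lemma same_point_product:
  assumes j: "j < v" and c: "c < m" "c' < m" "c \<noteq> c'"
  shows "norm (col F (j * m + c) \<bullet>c col F (j * m + c')) = 1 / r"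
proof -
  let ?I = "{i. i < M \<and> inc i j}"
  let ?g = "\<lambda>i. H j $$ (i, c) * conjugate (H j $$ (i, c'))"
  have sub: "s j ` ?I \<subseteq> {..<m}" using s_less j by auto
  \<comment> \<open>\<open>s j\<close> is injective and there are \<open>r\<close> blocks through \<open>j\<close>, so one row index is missed.\<close>
  have "card (s j ` ?I) = r" using card_image[OF s_inj[OF j]] blocks_through[OF j] by simp
  then have "card ({..<m} - s j ` ?I) = 1"
    using sub by (subst card_Diff_subset) (auto simp: m_eq intro: finite_subset)
  then obtain t where t: "{..<m} - s j ` ?I = {t}" by (rule card_1_singletonE)
  have "(\<Sum>i<m. ?g i) = sum ?g ({..<m} - s j ` ?I) + sum ?g (s j ` ?I)"
    by (rule sum.subset_diff[OF sub]) simp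
  moreover have "(\<Sum>i<m. ?g i) = 0"
    using unimodular_orthogonal_columns[OF conjugate_norm H[OF j] c] .
  moreover have "sum ?g (s j ` ?I) = (\<Sum>i\<in>?I. ?g (s j i))"
    using sum.reindex[OF s_inj[OF j]] by simp
  ultimately have "(\<Sum>i\<in>?I. ?g (s j i)) = - ?g t" unfolding t by (simp add: eq_neg_iff_add_eq_0 add.commute)
  moreover have "t < m" using t by auto
  then have "norm (?g t) = 1"
    using H[OF j] c unfolding unimodular_orthogonal_rows_def
    by (simp add: norm_mult norm_conjugate[OF conjugate_norm])
  ultimately show ?thesis
    using column_product[OF j j c(1,2)] by (simp add: norm_mult norm_divide)
qed

text \<open>
  The two columns have only the coordinate of the common block in their supports.
\<close>

lemma distinct_points_product:
  assumes j: "j < v" "j' < v" "j \<noteq> j'" and c: "c < m" "c' < m"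
  shows "norm (col F (j * m + c) \<bullet>c col F (j' * m + c')) = 1 / r"
proof -
  obtain i where i: "i < M" "inc i j" "inc i j'" and I: "{i. i < M \<and> inc i j \<and> inc i j'} = {i}"
    using common_block[OF j] by blast
  have "norm (H j $$ (s j i, c) * conjugate (H j' $$ (s j' i, c'))) = 1"
    using norm_H i j c by (simp add: norm_mult norm_conjugate[OF conjugate_norm])
  then show ?thesis
    using column_product[OF j(1,2) c] unfolding I by (simp add: norm_mult norm_divide)
qed

lemma equiangular_F: "equiangular F"
proof -
  have "vec_norm2 (col F n) = 1" if "n < v * m" for n
    using that by (rule index_cases) (simp only: column_norm)
  moreover have "norm (col F n \<bullet>c col F n') = 1 / r" if n: "n < v * m" "n' < v * m" "n \<noteq> n'" for n n'
  proof -
    obtain j c where j: "j < v" "c < m" "n = j * m + c" using n(1) by (rule index_cases)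
    obtain j' c' where j': "j' < v" "c' < m" "n' = j' * m + c'" using n(2) by (rule index_cases)
    show ?thesis
    proof (cases "j = j'")
      case True
      then have "c \<noteq> c'" using j j' n by auto
      then show ?thesis using same_point_product[of j c c'] j j' True by simp
    next
      case False
      then show ?thesis using distinct_points_product[of j j' c c'] j j' by simp
    qed
  qed
  ultimately show ?thesis unfolding equiangular_def using F_carrier
    by (auto intro!: exI[of _ "1 / real r"])
qed

lemma sum_index: "(\<Sum>n<v * m. f n) = (\<Sum>j<v. \<Sum>c<m. f (j * m + c))"
proof -
  have "(\<Sum>n<v * m. f n) = (\<Sum>j<v. sum f {j * m..<j * m + m})"
    using sum.nat_group[of f m v] by simp
  moreover have "sum f {j * m..<j * m + m} = (\<Sum>c<m. f (j * m + c))" for j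
    using sum.shift_bounds_nat_ivl[of f 0 "j * m" m]
    by (simp add: atLeast0LessThan add.commute)
  ultimately show ?thesis by simp
qed

text \<open>
  The contribution of the point \<open>j\<close> vanishes unless both blocks contain \<open>j\<close>; then it is the product of
  the rows \<open>s j i\<close> and \<open>s j i'\<close> of \<open>H j\<close>, which are distinct for \<open>i \<noteq> i'\<close>. For \<open>i = i'\<close>, each of
  the \<open>k\<close> points of the block contributes \<open>(1 + r) / r\<close>.
\<close>

lemma row_product:
  assumes i: "i < M" "i' < M"
  shows "(\<Sum>n<v * m. F $$ (i, n) * conjugate (F $$ (i', n))) =
    (if i = i' then of_real (real k * (1 + real r) / real r) else 0)"
proof -
  have inner: "(\<Sum>c<m. F $$ (i, j * m + c) * conjugate (F $$ (i', j * m + c))) =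
      (if i = i' \<and> inc i j then of_real ((1 + real r) / real r) else 0)" if j: "j < v" for j
  proof -
    have "(\<Sum>c<m. F $$ (i, j * m + c) * conjugate (F $$ (i', j * m + c))) =
      (\<Sum>c<m. of_real (1 / r) * (if inc i j \<and> inc i' j
        then H j $$ (s j i, c) * conjugate (H j $$ (s j i', c)) else 0))"
      using i j by (intro sum.cong refl F_product) auto
    also have "\<dots> = of_real (1 / r) * (if inc i j \<and> inc i' j
        then (\<Sum>c<m. H j $$ (s j i, c) * conjugate (H j $$ (s j i', c))) else 0)"
      unfolding sum_distrib_left[symmetric] by (cases "inc i j"; cases "inc i' j") simp_all
    also have "\<dots> = of_real (1 / r) * (if inc i j \<and> inc i' j
        then (if s j i = s j i' then of_nat m else 0) else 0)"
      using unimodular_row_products[OF conjugate_norm H[OF j]] s_less[OF j] i by auto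
    also have "\<dots> = of_real (1 / r) * (if i = i' \<and> inc i j then of_nat m else 0)"
      using inj_onD[OF s_inj[OF j], of i i'] i by auto
    also have "\<dots> = (if i = i' \<and> inc i j then of_real ((1 + real r) / real r) else 0)"
      by (cases "i = i'"; cases "inc i j") (simp_all add: m_eq)
    finally show ?thesis .
  qed
  have "(\<Sum>n<v * m. F $$ (i, n) * conjugate (F $$ (i', n))) =
      (\<Sum>j<v. if i = i' \<and> inc i j then of_real ((1 + real r) / real r) else 0)"
    unfolding sum_index using inner by (intro sum.cong) auto
  also have "\<dots> = (if i = i' then (\<Sum>j | j < v \<and> inc i j. of_real ((1 + real r) / real r)) else 0)"
    by (subst sum.inter_filter[symmetric]) (auto intro!: sum.cong)
  also have "\<dots> = (if i = i' then of_real (real k * (1 + real r) / real r) else 0)"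
    using points_on[OF i(1)] by (cases "i = i'") simp_all
  finally show ?thesis .
qed

lemma tight_frame_F: "tight_frame F"
proof -
  let ?A = "real k * (1 + real r) / real r"
  have "F * mat_adjoint F = of_real ?A \<cdot>\<^sub>m 1\<^sub>m M"
  proof (rule eq_matI)
    fix i i' assume "i < dim_row (of_real ?A \<cdot>\<^sub>m 1\<^sub>m M :: 'a mat)"
      "i' < dim_col (of_real ?A \<cdot>\<^sub>m 1\<^sub>m M :: 'a mat)"
    then have i: "i < M" "i' < M" by auto
    then show "(F * mat_adjoint F) $$ (i, i') = (of_real ?A \<cdot>\<^sub>m 1\<^sub>m M) $$ (i, i')"
      using F_carrier row_product[OF i] by (subst mult_mat_adjoint_index) auto
  qed (use F_carrier in \<open>auto simp: mat_adjoint_def\<close>)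
  moreover have "?A > 0" using k_pos r_pos by simp
  ultimately show ?thesis unfolding tight_frame_def using F_carrier by auto
qed

lemma F_nonzero_iff:
  assumes "i < M" "j < v" "c < m"
  shows "F $$ (i, j * m + c) \<noteq> 0 \<longleftrightarrow> inc i j"
  using F_index[OF assms] norm_H[OF assms(2,1) _ assms(3)] r_pos by auto

lemma card_nonzero_entries:
  "card {(i, n). i < M \<and> n < v * m \<and> F $$ (i, n) \<noteq> 0} = M * (k * m)"
proof -
  have row: "card {n. n < v * m \<and> F $$ (i, n) \<noteq> 0} = k * m" if i: "i < M" for i
  proof -
    have "card {n. n < v * m \<and> F $$ (i, n) \<noteq> 0} = (\<Sum>n<v * m. if F $$ (i, n) \<noteq> 0 then 1 else 0)"
      by (subst sum.inter_filter[symmetric]) (auto simp: lessThan_def)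
    also have "\<dots> = (\<Sum>j<v. \<Sum>c<m. if inc i j then 1 else 0)"
      unfolding sum_index using i F_nonzero_iff by (intro sum.cong refl if_cong) auto
    also have "\<dots> = (\<Sum>j<v. if inc i j then m else 0)"
      by (intro sum.cong) auto
    also have "\<dots> = (\<Sum>j | j < v \<and> inc i j. m)"
      by (subst sum.inter_filter[symmetric]) (auto intro!: sum.cong)
    also have "\<dots> = k * m" using points_on[OF i] by simp
    finally show ?thesis .
  qed
  have "{(i, n). i < M \<and> n < v * m \<and> F $$ (i, n) \<noteq> 0} =
      (SIGMA i:{..<M}. {n. n < v * m \<and> F $$ (i, n) \<noteq> 0})" by auto
  then show ?thesis using row by simp
qed

lemma density_F:
  assumes "0 < M"
  shows "density F = real k / real v"
proof -
  have "density F = real (M * (k * m)) / real (M * (v * m))"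
    unfolding density_def using F_carrier card_nonzero_entries by simp
  also have "\<dots> = real k / real v"
  proof -
    have "0 < m" by (simp add: m_eq)
    then show ?thesis using assms by simp
  qed
  finally show ?thesis .
qed

end

lemma steiner_construction_frame:
  fixes F :: "'a::{conjugatable_field, real_normed_field} mat"
  assumes cn: "\<And>z :: 'a. z * conjugate z = of_real ((norm z)\<^sup>2)"
    and AT: "AT \<in> carrier_mat M v"
    and inc: "steiner_incidence M v k r (\<lambda>i j. AT $$ (i, j) = 1)"
    and kv: "2 \<le> k" "k \<le> v" "r * (k - 1) = v - 1"
    and F: "steiner_construction k v r AT F"
  obtains H s where "steiner_frame M v k r (\<lambda>i j. AT $$ (i, j) = 1) (1 + r) H s F"
proof -
  interpret steiner_incidence M v k r "\<lambda>i j. AT $$ (i, j) = 1" by (fact inc)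
  have row: "dim_row AT = M" using AT by simp
  obtain H s where H: "\<And>j. j < v \<Longrightarrow> unimodular_orthogonal_rows (1 + r) (H j)"
    and s: "\<And>j. j < v \<Longrightarrow> inj_on (s j) {i. i < M \<and> AT $$ (i, j) = 1}"
      "\<And>i j. j < v \<Longrightarrow> i < M \<Longrightarrow> AT $$ (i, j) = 1 \<Longrightarrow> s j i < 1 + r"
    and F_eq: "F = of_real (sqrt ((real k - 1) / (real v - 1))) \<cdot>\<^sub>m
      hconcat M (map (\<lambda>j. replace_ones (1 + r) AT j (H j) (s j)) [0..<v])"
    using F unfolding steiner_construction_def row by blast
  have "real r * (real k - 1) = real v - 1"
    using arg_cong[OF kv(3), of real] kv by (simp add: of_nat_diff)
  moreover have "real k - 1 \<noteq> 0" "real v - 1 \<noteq> 0" using kv by auto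
  ultimately have "(real k - 1) / (real v - 1) = 1 / real r" using r_pos by (simp add: field_simps)
  then have scale: "sqrt ((real k - 1) / (real v - 1)) = 1 / sqrt (real r)"
    by (simp add: real_sqrt_divide)
  let ?Fs = "map (\<lambda>j. replace_ones (1 + r) AT j (H j) (s j)) [0..<v]"
  have Fs: "A \<in> carrier_mat M (1 + r)" if "A \<in> set ?Fs" for A
    using that row unfolding replace_ones_def by auto
  have C: "hconcat M ?Fs \<in> carrier_mat M (v * (1 + r))" using hconcat_carrier[of ?Fs, OF Fs] by simp
  have "steiner_frame M v k r (\<lambda>i j. AT $$ (i, j) = 1) (1 + r) H s F"
  proof (unfold_locales, fact cn, fact refl, fact H, fact s(1), fact s(2))
    show "F \<in> carrier_mat M (v * (1 + r))" unfolding F_eq using C by simp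
    fix i j c assume i: "i < M" "j < v" "c < 1 + r"
    have "j * (1 + r) + c < v * (1 + r)" using i by (intro block_index_less)
    then have "F $$ (i, j * (1 + r) + c) =
        of_real (1 / sqrt (real r)) * hconcat M ?Fs $$ (i, j * (1 + r) + c)"
      using C i unfolding F_eq scale by (subst index_smult_mat) auto
    also have "hconcat M ?Fs $$ (i, j * (1 + r) + c) = ?Fs ! j $$ (i, c)"
      using i by (intro hconcat_index Fs) auto
    also have "\<dots> = (if AT $$ (i, j) = 1 then H j $$ (s j i, c) else 0)"
      using i row s(2)[of j i] H[of j] unfolding replace_ones_def unimodular_orthogonal_rows_def
      by (auto simp: mat_of_rows_index)
    finally show "F $$ (i, j * (1 + r) + c) =
      of_real (1 / sqrt (real r)) * (if AT $$ (i, j) = 1 then H j $$ (s j i, c) else 0)" .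
  qed
  then show ?thesis by (rule that)
qed

text \<open>
  One matrix \<open>H\<close> serves all points, and distinct rows can be assigned to the \<open>r\<close> blocks through a
  point since \<open>H\<close> has \<open>1 + r\<close> rows.
\<close>

lemma steiner_construction_exists:
  fixes H :: "'a::{conjugatable_field, real_normed_field} mat"
  assumes AT: "AT \<in> carrier_mat M v"
    and inc: "steiner_incidence M v k r (\<lambda>i j. AT $$ (i, j) = 1)"
    and H: "unimodular_orthogonal_rows (1 + r) H"
  shows "\<exists>F :: 'a mat. steiner_construction k v r AT F"
proof -
  interpret steiner_incidence M v k r "\<lambda>i j. AT $$ (i, j) = 1" by (fact inc)
  let ?I = "\<lambda>j. {i. i < dim_row AT \<and> AT $$ (i, j) = 1}"
  define s where "s j = (SOME f. f ` ?I j \<subseteq> {..<1 + r} \<and> inj_on f (?I j))" for j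
  have s: "s j ` ?I j \<subseteq> {..<1 + r} \<and> inj_on (s j) (?I j)" if "j < v" for j
  proof -
    have "card (?I j) \<le> card {..<1 + r}" using blocks_through[OF that] AT by simp
    then have "\<exists>f. f ` ?I j \<subseteq> {..<1 + r} \<and> inj_on f (?I j)" by (intro card_le_inj) auto
    then show ?thesis unfolding s_def by (rule someI_ex)
  qed
  have "\<forall>j<v. inj_on (s j) (?I j) \<and> (\<forall>i<dim_row AT. AT $$ (i, j) = 1 \<longrightarrow> s j i < 1 + r)"
  proof (intro allI impI conjI)
    fix j assume "j < v"
    then show "inj_on (s j) (?I j)" using s by simp
    fix i assume "i < dim_row AT" "AT $$ (i, j) = 1"
    then have "s j i \<in> s j ` ?I j" by simp
    then show "s j i < 1 + r" using s[OF \<open>j < v\<close>] by (simp only: lessThan_iff[symmetric]) (elim conjE subsetD)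
  qed
  then show ?thesis unfolding steiner_construction_def using H
    by (intro exI[of _ "of_real (sqrt ((real k - 1) / (real v - 1))) \<cdot>\<^sub>m
      hconcat (dim_row AT) (map (\<lambda>j. replace_ones (1 + r) AT j H (s j)) [0..<v])"]
      exI[of _ "\<lambda>_. H"] exI[of _ s]) simp
qed

lemma steiner_construction_etf:
  fixes F :: "'a::{conjugatable_field, real_normed_field} mat"
  assumes cn: "\<And>z :: 'a. z * conjugate z = of_real ((norm z)\<^sup>2)"
    and AT: "AT \<in> carrier_mat M v"
    and inc: "steiner_incidence M v k r (\<lambda>i j. AT $$ (i, j) = 1)"
    and kv: "2 \<le> k" "k \<le> v" "r * (k - 1) = v - 1" and M: "0 < M"
    and F: "steiner_construction k v r AT F"
  shows "F \<in> carrier_mat M (v * (1 + r))" "equiangular_tight_frame F"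
    "density F = real k / real v"
proof -
  obtain H s where "steiner_frame M v k r (\<lambda>i j. AT $$ (i, j) = 1) (1 + r) H s F"
    using steiner_construction_frame[OF cn AT inc kv F] .
  then interpret steiner_frame M v k r "\<lambda>i j. AT $$ (i, j) = 1" "1 + r" H s F .
  show "F \<in> carrier_mat M (v * (1 + r))" by (fact F_carrier)
  show "equiangular_tight_frame F"
    unfolding equiangular_tight_frame_def using equiangular_F tight_frame_F by simp
  show "density F = real k / real v" using M by (rule density_F)
qed

section \<open>Parameters of the frame\<close>

text \<open>
  The two counting identities determine everything; the closed form of the density comes from
  \<open>N - 1 = r (k + v - 1)\<close> and \<open>N - M = v (k + v - 1) / k\<close>, whose common factor cancels.
\<close>

lemma steiner_parameters:
  fixes k v r M N :: real
  assumes k: "1 < k" and v: "1 < v" and r: "r * (k - 1) = v - 1" and M: "M * k = v * r"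
    and N: "N = v * (1 + r)"
  shows "r = (v - 1) / (k - 1)" "M = v * (v - 1) / (k * (k - 1))"
    "N = v * (1 + (v - 1) / (k - 1))" "N / M = k * (1 + (k - 1) / (v - 1))"
    "k / v = sqrt ((N - 1) / (M * (N - M)))"
proof -
  show r': "r = (v - 1) / (k - 1)" using r k by (simp add: eq_divide_eq)
  show "N = v * (1 + (v - 1) / (k - 1))" unfolding N r' ..
  have M': "M = v * r / k" using M k by (simp add: eq_divide_eq)
  then show "M = v * (v - 1) / (k * (k - 1))" unfolding r' by simp
  have r0: "0 < r" unfolding r' using k v by simp
  have "N / M = k * (1 + 1 / r)" unfolding N M' using k v r0 by (simp add: field_simps)
  then show "N / M = k * (1 + (k - 1) / (v - 1))" unfolding r' by simp
  have "N - M = v * (k + k * r - r) / k" unfolding N M' using k by (simp add: field_simps)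
  also have "k + k * r - r = k + v - 1" using r by (simp add: algebra_simps)
  finally have NM: "N - M = v * (k + v - 1) / k" .
  have "N - 1 = r * (k - 1) + v * r" unfolding N r by (simp add: algebra_simps)
  then have N1: "N - 1 = r * (k + v - 1)" by (simp add: algebra_simps)
  have "k + v - 1 \<noteq> 0" using k v by simp
  then have "(N - 1) / (M * (N - M)) = (k / v)\<^sup>2"
    unfolding N1 NM unfolding M' using k v r0 by (simp add: power2_eq_square)
  then show "k / v = sqrt ((N - 1) / (M * (N - M)))" using k v by simp
qed

theorem theorem1:
  fixes k v r M N :: nat
    and V :: "'p set" and \<B> :: "'p set set"
    and ps :: "'p list" and bs :: "'p set list"
    and AT :: "nat mat"
  assumes "2 \<le> k" and "k \<le> v"
    and "steiner_system k v V \<B>"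
    and "distinct ps" and "set ps = V"
    and "distinct bs" and "set bs = \<B>"
    and "AT = transpose_mat (incidence_matrix ps bs)"
    and "r = (v - 1) div (k - 1)"
    and "M = (v * (v - 1)) div (k * (k - 1))"
    and "N = v * (1 + r)"
  shows
    "real r = (real v - 1) / (real k - 1)
     \<and> real M = (real v * (real v - 1)) / (real k * (real k - 1))
     \<and> real N = real v * (1 + (real v - 1) / (real k - 1))
     \<and> AT \<in> carrier_mat M v
     \<and> real N / real M = real k * (1 + (real k - 1) / (real v - 1))
     \<and> real k / real v = sqrt ((real N - 1) / (real M * (real N - real M)))
     \<and> (\<exists>F :: complex mat. steiner_construction k v r AT F
          \<and> F \<in> carrier_mat M N
          \<and> equiangular_tight_frame F
          \<and> redundancy F = real k * (1 + (real k - 1) / (real v - 1))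
          \<and> density F = real k / real v)
     \<and> ((\<exists>H. real_hadamard (1 + r) H) \<longrightarrow>
          (\<exists>F :: real mat. steiner_construction k v r AT F
            \<and> F \<in> carrier_mat M N
            \<and> equiangular_tight_frame F
            \<and> redundancy F = real k * (1 + (real k - 1) / (real v - 1))
            \<and> density F = real k / real v))
     \<and> (\<forall>F :: complex mat. steiner_construction k v r AT F \<longrightarrow>
          F \<in> carrier_mat M N
          \<and> equiangular_tight_frame F
          \<and> redundancy F = real k * (1 + (real k - 1) / (real v - 1))
          \<and> density F = real k / real v)
     \<and> (\<forall>F :: real mat. steiner_construction k v r AT F \<longrightarrow>
          F \<in> carrier_mat M N
          \<and> equiangular_tight_frame F
          \<and> redundancy F = real k * (1 + (real k - 1) / (real v - 1))
          \<and> density F = real k / real v)"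
proof -
  note sys = steiner_system_incidence[OF assms(1-10)]
  interpret steiner_incidence M v k r "\<lambda>i j. AT $$ (i, j) = 1" by (fact sys(4))
  have kv: "1 < real k" "1 < real v" using assms(1,2) by simp_all
  have "real r * (real k - 1) = real v - 1"
    using arg_cong[OF sys(1), of real] assms(1,2) by (simp add: of_nat_diff)
  moreover have "real M * real k = real v * real r"
    using arg_cong[OF sys(2), of real] by simp
  moreover have "real N = real v * (1 + real r)" unfolding assms(11) by (simp only: of_nat_mult of_nat_add of_nat_1)
  ultimately have par: "real r = (real v - 1) / (real k - 1)"
    "real M = (real v * (real v - 1)) / (real k * (real k - 1))"
    "real N = real v * (1 + (real v - 1) / (real k - 1))"
    "real N / real M = real k * (1 + (real k - 1) / (real v - 1))"
    "real k / real v = sqrt ((real N - 1) / (real M * (real N - real M)))"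
    by (rule steiner_parameters[OF kv])+
  have M: "0 < M" using sys(2) r_pos assms(1,2) by (intro gr0I) simp
  have complex_norm: "z * conjugate z = of_real ((norm z)\<^sup>2)" for z :: complex
    by (simp only: conjugate_complex_def complex_norm_square)
  have real_norm: "z * conjugate z = of_real ((norm z)\<^sup>2)" for z :: real
    by (simp add: power2_eq_square)
  have complex_frames: "F \<in> carrier_mat M N \<and> equiangular_tight_frame F
      \<and> redundancy F = real k * (1 + (real k - 1) / (real v - 1))
      \<and> density F = real k / real v"
    if "steiner_construction k v r AT F" for F :: "complex mat"
    using steiner_construction_etf[OF complex_norm sys(3,4) assms(1,2) sys(1) M that] par(4)
    unfolding redundancy_def assms(11) by simp
  have real_frames: "F \<in> carrier_mat M N \<and> equiangular_tight_frame F
      \<and> redundancy F = real k * (1 + (real k - 1) / (real v - 1))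
      \<and> density F = real k / real v"
    if "steiner_construction k v r AT F" for F :: "real mat"
    using steiner_construction_etf[OF real_norm sys(3,4) assms(1,2) sys(1) M that] par(4)
    unfolding redundancy_def assms(11) by simp
  have complex_exists: "\<exists>F :: complex mat. steiner_construction k v r AT F"
    using steiner_construction_exists[OF sys(3,4)]
      fourier_matrix_unimodular_orthogonal_rows[of "1 + r"] by simp
  have real_exists: "\<exists>F :: real mat. steiner_construction k v r AT F"
    if "\<exists>H. real_hadamard (1 + r) H"
    using steiner_construction_exists[OF sys(3,4)] real_hadamard_unimodular_orthogonal_rows that
    by blast
  show ?thesis
    using par sys(3) complex_frames real_frames complex_exists real_exists by blast
qed

end
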